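(* Let $\Gamma$ be an infinite cardinal with $\Gamma^\omega=\Gamma$ and let $\mathcal{D}$ be a subgroup of $\ell_1(\Gamma)$ obtained by the transfinite construction described in the context. Then \[ \mathcal{D}\cap 2S_{\ell_1(\Gamma)}\subseteq\{\pm 2e_\alpha\}_{\alpha<\Gamma}. \] In particular, the tiling $\mathcal{T}=\{d+B_{\ell_1(\Gamma)}\}_{d\in\mathcal{D}}$ of $\ell_1(\Gamma)$ is point-$2$-finite (every point of $\ell_1(\Gamma)$ belongs to at most $2$ elements of $\mathcal{T}$), and the only points of $B_{\ell_1(\Gamma)}$ that can belong to another tile of $\mathcal{T}$ are $\{\pm e_\alpha\}_{\alpha<\Gamma}$.
   Context: All spaces are over the real field. Cardinals are regarded as initial ordinals and $\Gamma^\omega$ denotes cardinal exponentiation. $B_{\ell_1(\Gamma)}$ and $S_{\ell_1(\Gamma)}$ are the closed unit ball and unit sphere of $\ell_1(\Gamma)$ in the canonical norm $\|\cdot\|_1$, $(e_\alpha)_{\alpha<\Gamma}$ is the canonical basis, and $\operatorname{supp}(x)=\{\alpha<\Gamma\colon x(\alpha)\neq0\}$. Construction of $\mathcal{D}$. Since $\Gamma^\omega=\Gamma$, one has $|\ell_1(\Gamma)|=\Gamma$; fix an injective enumeration $\ell_1(\Gamma)=\{u_\alpha\}_{\alpha<\Gamma}$ with $u_0=0$. Define an increasing chain $(\mathcal{D}_\alpha)_{\alpha<\Gamma}$ of subgroups of $\ell_1(\Gamma)$, with $|\mathcal{D}_\alpha|\leq\max\{|\alpha|,\omega\}$, by transfinite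 recursion. Put $\mathcal{D}_0=\{0\}$. Given $0<\gamma<\Gamma$ and $(\mathcal{D}_\alpha)_{\alpha<\gamma}$, let $\mathcal{E}_\gamma=\bigcup_{\alpha<\gamma}\mathcal{D}_\alpha$. If there is $d\in\mathcal{E}_\gamma$ with $\|u_\gamma-d\|_1\leq1$, put $\mathcal{D}_\gamma=\mathcal{E}_\gamma$. Otherwise (so $\|u_\gamma-d\|_1>1$ for all $d\in\mathcal{E}_\gamma$), let $\Gamma_0=\operatorname{supp}(u_\gamma)\cup\bigcup\{\operatorname{supp}(d)\colon d\in\mathcal{E}_\gamma\}$, which has cardinality less than $\Gamma$, choose some $\tilde\gamma\in\Gamma\setminus\Gamma_0$, and put $\mathcal{D}_\gamma=\mathcal{E}_\gamma+(u_\gamma+e_{\tilde\gamma})\mathbb{Z}$. Finally $\mathcal{D}=\bigcup_{\alpha<\Gamma}\mathcal{D}_\alpha$. The subgroup $\mathcal{D}$ so obtained satisfies $\|d-h\|_1\geq 2$ for all distinct $d,h\in\mathcal{D}$, and every $x\in\ell_1(\Gamma)$ is at distance at most $1$ from some element of $\mathcal{D}$; hence $\{d+B_{\ell_1(\Gamma)}\}_{d\in\mathcal{D}}$ is a tiling, i.e., these balls cover $\ell_1(\Gamma)$ and have mutually disjoint interiors. *)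

theory Defs
  imports "HOL-Analysis.Analysis"
begin

unbundle cardinal_syntax

section \<open>The real Banach space $\ell_1(\Gamma)$\<close>

text \<open>The points of the type \<open>'a\<close> are the ordinals below the cardinal \<open>\<Gamma>\<close>; the well-order that
  makes them so is a separate parameter \<open>r\<close> below, since the space itself does not depend on it.\<close>

typedef 'a ell1 = "{x :: 'a \<Rightarrow> real. (\<lambda>\<alpha>. \<bar>x \<alpha>\<bar>) summable_on UNIV}"
  morphisms coord Abs_ell1
  by (rule exI[of _ "\<lambda>_. 0"]) simp

setup_lifting type_definition_ell1

lemma coord_summable: "(\<lambda>\<alpha>. \<bar>coord x \<alpha>\<bar>) summable_on UNIV"
  using coord[of x] by simp

lemma ell1_eqI: "(\<And>\<alpha>. coord x \<alpha> = coord y \<alpha>) \<Longrightarrow> x = y"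
  by (simp add: coord_inject[symmetric] ext)

lemma ell1_abs_summable_add:
  fixes f g :: "'a \<Rightarrow> real"
  assumes "(\<lambda>\<alpha>. \<bar>f \<alpha>\<bar>) summable_on UNIV" "(\<lambda>\<alpha>. \<bar>g \<alpha>\<bar>) summable_on UNIV"
  shows "(\<lambda>\<alpha>. \<bar>f \<alpha> + g \<alpha>\<bar>) summable_on UNIV"
  by (rule summable_on_comparison_test[OF summable_on_add[OF assms]]) auto

instantiation ell1 :: (type) real_normed_vector
begin

lift_definition zero_ell1 :: "'a ell1" is "\<lambda>_. 0" by simp

lift_definition plus_ell1 :: "'a ell1 \<Rightarrow> 'a ell1 \<Rightarrow> 'a ell1" is "\<lambda>x y \<alpha>. x \<alpha> + y \<alpha>"
  by (rule ell1_abs_summable_add)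

lift_definition uminus_ell1 :: "'a ell1 \<Rightarrow> 'a ell1" is "\<lambda>x \<alpha>. - x \<alpha>" by simp

lift_definition minus_ell1 :: "'a ell1 \<Rightarrow> 'a ell1 \<Rightarrow> 'a ell1" is "\<lambda>x y \<alpha>. x \<alpha> - y \<alpha>"
  subgoal for x y using ell1_abs_summable_add[of x "\<lambda>\<alpha>. - y \<alpha>"] by simp
  done

lift_definition scaleR_ell1 :: "real \<Rightarrow> 'a ell1 \<Rightarrow> 'a ell1" is "\<lambda>c x \<alpha>. c * x \<alpha>"
  by (simp add: abs_mult summable_on_cmult_right)

lift_definition norm_ell1 :: "'a ell1 \<Rightarrow> real" is "\<lambda>x. \<Sum>\<^sub>\<infinity>\<alpha>. \<bar>x \<alpha>\<bar>" .

definition sgn_ell1 :: "'a ell1 \<Rightarrow> 'a ell1" where "sgn_ell1 x = inverse (norm x) *\<^sub>R x"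

definition dist_ell1 :: "'a ell1 \<Rightarrow> 'a ell1 \<Rightarrow> real" where "dist_ell1 x y = norm (x - y)"

definition uniformity_ell1 :: "('a ell1 \<times> 'a ell1) filter" where
  "uniformity_ell1 = (INF e\<in>{0<..}. principal {(x, y). dist x y < e})"

definition open_ell1 :: "'a ell1 set \<Rightarrow> bool" where
  "open_ell1 U \<longleftrightarrow> (\<forall>x\<in>U. eventually (\<lambda>(x', y). x' = x \<longrightarrow> y \<in> U) uniformity)"

instance
proof
  fix x y z :: "'a ell1" and a b :: real
  show "dist x y = norm (x - y)" by (rule dist_ell1_def)
  show "sgn x = inverse (norm x) *\<^sub>R x" by (rule sgn_ell1_def)
  show "(uniformity :: ('a ell1 \<times> 'a ell1) filter)
      = (INF e\<in>{0<..}. principal {(x, y). dist x y < e})"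
    by (rule uniformity_ell1_def)
  show "open U \<longleftrightarrow> (\<forall>x\<in>U. eventually (\<lambda>(x', y). x' = x \<longrightarrow> y \<in> U) uniformity)"
    for U :: "'a ell1 set" by (rule open_ell1_def)
  show "x + y + z = x + (y + z)" "x + y = y + x" "0 + x = x" "- x + x = 0" "x - y = x + - y"
    by (transfer; simp add: algebra_simps)+
  show "a *\<^sub>R (x + y) = a *\<^sub>R x + a *\<^sub>R y" "(a + b) *\<^sub>R x = a *\<^sub>R x + b *\<^sub>R x"
    "a *\<^sub>R b *\<^sub>R x = (a * b) *\<^sub>R x" "1 *\<^sub>R x = x"
    by (transfer; simp add: algebra_simps)+
  show "norm (a *\<^sub>R x) = \<bar>a\<bar> * norm x"
    by transfer (simp add: abs_mult infsum_cmult_right')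
  show "norm x = 0 \<longleftrightarrow> x = 0"
  proof
    assume "norm x = 0"
    then have 0: "(\<Sum>\<^sub>\<infinity>\<alpha>. \<bar>coord x \<alpha>\<bar>) = 0" by (simp add: norm_ell1.rep_eq)
    show "x = 0"
    proof (rule ell1_eqI)
      fix \<alpha>
      have "\<bar>coord x \<alpha>\<bar> = 0"
        using nonneg_infsum_le_0D[of "\<lambda>\<alpha>. \<bar>coord x \<alpha>\<bar>" UNIV \<alpha>] 0 coord_summable[of x] by simp
      then show "coord x \<alpha> = coord 0 \<alpha>" by (simp add: zero_ell1.rep_eq)
    qed
  qed (simp add: norm_ell1.rep_eq zero_ell1.rep_eq)
  show "norm (x + y) \<le> norm x + norm y"
  proof -
    note s = coord_summable[of x] coord_summable[of y]
    have "(\<Sum>\<^sub>\<infinity>\<alpha>. \<bar>coord x \<alpha> + coord y \<alpha>\<bar>) \<le> (\<Sum>\<^sub>\<infinity>\<alpha>. \<bar>coord x \<alpha>\<bar> + \<bar>coord y \<alpha>\<bar>)"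
      by (rule infsum_mono[OF ell1_abs_summable_add[OF s] summable_on_add[OF s]]) auto
    also have "\<dots> = (\<Sum>\<^sub>\<infinity>\<alpha>. \<bar>coord x \<alpha>\<bar>) + (\<Sum>\<^sub>\<infinity>\<alpha>. \<bar>coord y \<alpha>\<bar>)"
      by (rule infsum_add[OF s])
    finally show ?thesis by (simp add: norm_ell1.rep_eq plus_ell1.rep_eq)
  qed
qed

end

lift_definition basis :: "'a \<Rightarrow> 'a ell1" is "\<lambda>\<alpha> \<beta>. if \<beta> = \<alpha> then 1 else 0"
  subgoal for \<alpha>
    using summable_on_cong_neutral[of UNIV "{\<alpha>}" "\<lambda>\<beta>. \<bar>if \<beta> = \<alpha> then 1 else 0 :: real\<bar>" "\<lambda>_. 1"] by simp
  done

definition supp :: "'a ell1 \<Rightarrow> 'a set" where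
  "supp x = {\<alpha>. coord x \<alpha> \<noteq> 0}"


section \<open>The transfinite construction\<close>

text \<open>In a cardinal order \<open>r\<close>, \<open>underS r \<gamma>\<close> is the set of \<open>\<alpha> < \<gamma>\<close>; it is empty exactly for the
  ordinal \<open>0\<close>. The free choice of the new coordinate at each stage makes the construction a
  property of the family \<open>DD\<close> rather than a function of \<open>r\<close> and \<open>u\<close>.\<close>

definition E_stage :: "'a rel \<Rightarrow> ('a \<Rightarrow> 'a ell1 set) \<Rightarrow> 'a \<Rightarrow> 'a ell1 set" where
  "E_stage r DD \<gamma> = (\<Union>\<alpha>\<in>underS r \<gamma>. DD \<alpha>)"

definition transfinite_construction ::
  "'a rel \<Rightarrow> ('a \<Rightarrow> 'a ell1) \<Rightarrow> ('a \<Rightarrow> 'a ell1 set) \<Rightarrow> bool" where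
  "transfinite_construction r u DD \<longleftrightarrow>
    (\<forall>\<gamma>.
      if underS r \<gamma> = {} then DD \<gamma> = {0}
      else if \<exists>d\<in>E_stage r DD \<gamma>. norm (u \<gamma> - d) \<le> 1 then DD \<gamma> = E_stage r DD \<gamma>
      else \<exists>\<gamma>'. \<gamma>' \<notin> supp (u \<gamma>) \<union> (\<Union>d\<in>E_stage r DD \<gamma>. supp d) \<and>
        DD \<gamma> = {d + of_int k *\<^sub>R (u \<gamma> + basis \<gamma>') | d k. d \<in> E_stage r DD \<gamma>})"


section \<open>Families of sets\<close>

definition tiles :: "'a ell1 set \<Rightarrow> 'a ell1 set set" where
  "tiles D = {(+) d ` cball 0 1 | d. d \<in> D}"

definition point_n_finite :: "nat \<Rightarrow> 'b set set \<Rightarrow> bool" where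
  "point_n_finite n \<T> \<longleftrightarrow> (\<forall>x. finite {T\<in>\<T>. x \<in> T} \<and> card {T\<in>\<T>. x \<in> T} \<le> n)"

end

(* A nonzero d + k (u + e), where the new basis vector e avoids the supports of d and u, has norm
   norm (d + k u) + \<bar>k\<bar>. For \<bar>k\<bar> = 1 the first summand exceeds 1, because u is at distance more than 1
   from the previous stage, which is a group; for \<bar>k\<bar> \<ge> 2 the norm is 2 only if d + k u = 0 and
   \<bar>k\<bar> = 2, and the element is then 2 e or -2 e. Among three distinct tiles through one point, two
   differences of consecutive centres would be 2-multiples of signed basis vectors, and their sum,
   the third difference, would have norm 4 or 0. *)

theory Submission
  imports Defs
begin

section \<open>Norms of vectors with disjoint supports\<close>

lemma norm_add_disjoint_supp:
  assumes "supp x \<inter> supp y = {}"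
  shows "norm (x + y) = norm x + norm y"
proof -
  have "\<bar>coord x \<alpha> + coord y \<alpha>\<bar> = \<bar>coord x \<alpha>\<bar> + \<bar>coord y \<alpha>\<bar>" for \<alpha>
    using assms by (cases "coord x \<alpha> = 0") (auto simp: supp_def)
  then show ?thesis
    by (simp add: norm_ell1.rep_eq plus_ell1.rep_eq infsum_add coord_summable)
qed

lemma supp_scaleR_basis: "supp (c *\<^sub>R basis \<alpha>) \<subseteq> {\<alpha>}"
  by (auto simp: supp_def scaleR_ell1.rep_eq basis.rep_eq)

lemma norm_basis [simp]: "norm (basis \<alpha>) = 1"
proof -
  have "(\<Sum>\<^sub>\<infinity>\<beta>. \<bar>coord (basis \<alpha>) \<beta>\<bar>) = (\<Sum>\<^sub>\<infinity>\<beta>\<in>{\<alpha>}. \<bar>coord (basis \<alpha>) \<beta>\<bar>)"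
    by (rule infsum_cong_neutral) (auto simp: basis.rep_eq)
  then show ?thesis
    by (simp add: norm_ell1.rep_eq basis.rep_eq)
qed

lemma norm_add_scaleR_basis:
  assumes "\<alpha> \<notin> supp x"
  shows "norm (x + c *\<^sub>R basis \<alpha>) = norm x + \<bar>c\<bar>"
  using norm_add_disjoint_supp[of x "c *\<^sub>R basis \<alpha>"] supp_scaleR_basis[of c \<alpha>] assms by auto

text \<open>The unit balls centred at 0 and at twice a basis vector touch only at the midpoint.
  Writing \<open>x = y + c *\<^sub>R basis \<alpha>\<close> with \<open>y\<close> vanishing at
  \<open>\<alpha>\<close>, the two bounds add up to
  \<open>2 * norm y + \<bar>c\<bar> + \<bar>c - 2\<bar> \<le> 2\<close>, while
  \<open>\<bar>c\<bar> + \<bar>c - 2\<bar>\<close> is at least 2. So \<open>y = 0\<close>, and then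
  both bounds force \<open>c = 1\<close>.\<close>

lemma eq_basis_if_norm_le_1:
  assumes "norm x \<le> 1" "norm (x - 2 *\<^sub>R basis \<alpha>) \<le> 1"
  shows "x = basis \<alpha>"
proof -
  define c where "c = coord x \<alpha>"
  define y where "y = x - c *\<^sub>R basis \<alpha>"
  have \<alpha>: "\<alpha> \<notin> supp y"
    by (simp add: y_def c_def supp_def minus_ell1.rep_eq scaleR_ell1.rep_eq basis.rep_eq)
  have "x = y + c *\<^sub>R basis \<alpha>" "x - 2 *\<^sub>R basis \<alpha> = y + (c - 2) *\<^sub>R basis \<alpha>"
    by (simp_all add: y_def scaleR_diff_left)
  then have "norm y + \<bar>c\<bar> \<le> 1" "norm y + \<bar>c - 2\<bar> \<le> 1"
    using assms norm_add_scaleR_basis[OF \<alpha>] by metis+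
  then have "c = 1" "norm y = 0"
    using norm_ge_zero[of y] by linarith+
  then show ?thesis
    by (simp add: y_def)
qed

section \<open>Separated subgroups and their extension by one generator\<close>

definition signed_basis :: "'a ell1 set" where
  "signed_basis = {basis \<alpha> | \<alpha>. True} \<union> {- basis \<alpha> | \<alpha>. True}"

text \<open>The invariant of the recursion. Containing 0 and being closed under differences makes
  \<open>A\<close> a subgroup; the last clause sharpens 2-separation by naming the only vectors that
  may attain norm 2.\<close>

definition two_separated_group :: "'a ell1 set \<Rightarrow> bool" where
  "two_separated_group A \<longleftrightarrow> 0 \<in> A \<and> (\<forall>x\<in>A. \<forall>y\<in>A. x - y \<in> A) \<and>
     (\<forall>x\<in>A. x = 0 \<or> norm x > 2 \<or> x \<in> (*\<^sub>R) 2 ` signed_basis)"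

lemma scaleR_2_signed_basis:
  "(*\<^sub>R) 2 ` signed_basis = {2 *\<^sub>R basis \<alpha> | \<alpha>. True} \<union> {- (2 *\<^sub>R basis \<alpha>) | \<alpha>. True}"
  by (force simp: signed_basis_def)

lemma norm_signed_basis: "x \<in> signed_basis \<Longrightarrow> norm x = 1"
  by (auto simp: signed_basis_def)

text \<open>For equal indices the coefficients add up to 0, 2 or -2; for different indices the
  supports are disjoint and the norms add. Hence a sum of two signed basis vectors is never a signed
  basis vector, which excludes three tiles through one point.\<close>

lemma norm_add_signed_basis:
  assumes "x \<in> signed_basis" "y \<in> signed_basis" "x + y \<noteq> 0"
  shows "norm (x + y) = 2"
proof -
  obtain a \<alpha> b \<beta> where xy: "x = a *\<^sub>R basis \<alpha>" "y = b *\<^sub>R basis \<beta>"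
    and ab: "a = 1 \<or> a = -1" "b = 1 \<or> b = -1"
  proof -
    have *: "\<exists>c \<gamma>. z = c *\<^sub>R basis \<gamma> \<and> (c = 1 \<or> c = -1)" if "z \<in> signed_basis" for z :: "'a ell1"
    proof -
      from that obtain \<gamma> where "z = 1 *\<^sub>R basis \<gamma> \<or> z = (-1) *\<^sub>R basis \<gamma>"
        by (auto simp: signed_basis_def)
      then show ?thesis by blast
    qed
    show thesis using *[OF assms(1)] *[OF assms(2)] that by blast
  qed
  show ?thesis
  proof (cases "\<alpha> = \<beta>")
    case True
    then have "x + y = (a + b) *\<^sub>R basis \<alpha>"
      by (simp add: xy scaleR_add_left)
    with assms(3) ab show ?thesis by auto
  next
    case False
    then have "\<beta> \<notin> supp x"
      using supp_scaleR_basis[of a \<alpha>] by (auto simp: xy)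
    with ab show ?thesis
      using norm_add_scaleR_basis[of \<beta> x b] by (auto simp: xy)
  qed
qed

lemma two_separated_group_minus:
  "two_separated_group A \<Longrightarrow> x \<in> A \<Longrightarrow> - x \<in> A"
  unfolding two_separated_group_def by (metis diff_0)

lemma two_separated_group_diff:
  "two_separated_group A \<Longrightarrow> x \<in> A \<Longrightarrow> y \<in> A \<Longrightarrow> x - y \<in> A"
  by (simp add: two_separated_group_def)

lemma two_separated_group_norm_le_2:
  assumes "two_separated_group A" "x \<in> A" "x \<noteq> 0" "norm x \<le> 2"
  shows "x \<in> (*\<^sub>R) 2 ` signed_basis"
  using assms by (force simp: two_separated_group_def)

text \<open>Elements of two members of the chain both lie in the larger one, which is closed under
  differences. The norm clause concerns single elements, and \<open>I \<noteq> {}\<close> supplies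
  0.\<close>

lemma two_separated_group_directed_Union:
  assumes "I \<noteq> {}" "\<And>i. i \<in> I \<Longrightarrow> two_separated_group (A i)"
    and dir: "\<And>i j. i \<in> I \<Longrightarrow> j \<in> I \<Longrightarrow> A i \<subseteq> A j \<or> A j \<subseteq> A i"
  shows "two_separated_group (\<Union>i\<in>I. A i)"
proof -
  have "x - y \<in> (\<Union>i\<in>I. A i)" if "i \<in> I" "j \<in> I" "x \<in> A i" "y \<in> A j" for i j x y
    using dir[OF that(1,2)] that assms(2) two_separated_group_diff by blast
  moreover have "0 \<in> (\<Union>i\<in>I. A i)"
    using assms(1,2) unfolding two_separated_group_def by blast
  moreover have "x = 0 \<or> norm x > 2 \<or> x \<in> (*\<^sub>R) 2 ` signed_basis" if "i \<in> I" "x \<in> A i" for i x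
    using assms(2)[OF that(1)] that(2) by (simp add: two_separated_group_def)
  ultimately show ?thesis
    unfolding two_separated_group_def by (intro conjI ballI) (blast | fast)+
qed

lemma two_separated_group_extend:
  assumes E: "two_separated_group E"
    and far: "\<And>d. d \<in> E \<Longrightarrow> norm (v - d) > 1"
    and \<alpha>: "\<alpha> \<notin> supp v" "\<And>d. d \<in> E \<Longrightarrow> \<alpha> \<notin> supp d"
  shows "two_separated_group {d + of_int k *\<^sub>R (v + basis \<alpha>) | d k. d \<in> E}" (is "two_separated_group ?A")
  unfolding two_separated_group_def
proof (intro conjI ballI)
  have mem: "d + of_int k *\<^sub>R (v + basis \<alpha>) \<in> ?A" if "d \<in> E" for d k
    using that by blast
  show "0 \<in> ?A"
    using mem[of 0 0] E by (simp add: two_separated_group_def)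
  fix x y assume "x \<in> ?A" "y \<in> ?A"
  then obtain d k d' k' where dk: "d \<in> E" "d' \<in> E"
      "x = d + of_int k *\<^sub>R (v + basis \<alpha>)" "y = d' + of_int k' *\<^sub>R (v + basis \<alpha>)"
    by blast
  then have "x - y = (d - d') + of_int (k - k') *\<^sub>R (v + basis \<alpha>)"
    by (simp add: scaleR_diff_left)
  moreover have "d - d' \<in> E"
    using E dk by (simp add: two_separated_group_def)
  ultimately show "x - y \<in> ?A" using mem[of "d - d'" "k - k'"] by simp
next
  fix x assume "x \<in> ?A"
  then obtain d k where d: "d \<in> E" and "x = d + of_int k *\<^sub>R (v + basis \<alpha>)"
    by blast
  then have x: "x = (d + of_int k *\<^sub>R v) + of_int k *\<^sub>R basis \<alpha>"
    by (simp add: scaleR_add_right)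
  have "\<alpha> \<notin> supp (d + of_int k *\<^sub>R v)"
    using \<alpha>(1) \<alpha>(2)[OF d] by (simp add: supp_def plus_ell1.rep_eq scaleR_ell1.rep_eq)
  then have n: "norm x = norm (d + of_int k *\<^sub>R v) + \<bar>of_int k\<bar>"
    unfolding x by (rule norm_add_scaleR_basis)
  consider "k = 0" | "k = 1" | "k = -1" | "\<bar>k\<bar> \<ge> 2" by linarith
  then show "x = 0 \<or> norm x > 2 \<or> x \<in> (*\<^sub>R) 2 ` signed_basis"
  proof cases
    case 1
    then show ?thesis using E d by (simp add: x two_separated_group_def)
  next
    case 2
    \<comment> \<open>\<open>far\<close> is applied to \<open>- d\<close>, which lies in the group
      \<open>E\<close>, because \<open>v - (- d)\<close> is \<open>d + v\<close>.\<close>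
    then show ?thesis
      using far[OF two_separated_group_minus[OF E d]] n by (simp add: add.commute)
  next
    case 3
    then show ?thesis
      using far[OF d] n by (simp add: norm_minus_commute)
  next
    case 4
    show ?thesis
    proof (cases "\<bar>k\<bar> = 2 \<and> d + of_int k *\<^sub>R v = 0")
      case True
      then have "x = of_int k *\<^sub>R basis \<alpha>" "k = 2 \<or> k = -2"
        unfolding x by auto
      then show ?thesis
        unfolding scaleR_2_signed_basis by auto
    next
      case False
      \<comment> \<open>As \<open>k\<close> is an integer, failure of the equality case leaves
        either one more unit in \<open>\<bar>k\<bar>\<close> or a positive first summand; each
        pushes the norm strictly above 2.\<close>
      with 4 have "\<bar>k\<bar> \<ge> 3 \<or> norm (d + of_int k *\<^sub>R v) > 0" by auto
      moreover have "\<bar>of_int k :: real\<bar> \<ge> 2" "\<bar>k\<bar> \<ge> 3 \<Longrightarrow> \<bar>of_int k :: real\<bar> \<ge> 3"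
        using 4 by linarith+
      ultimately have "norm x > 2"
        using n norm_ge_zero[of "d + of_int k *\<^sub>R v"] by linarith
      then show ?thesis by simp
    qed
  qed
qed

section \<open>The stages of the transfinite construction\<close>

lemma E_stage_subset:
  assumes "transfinite_construction r u DD"
  shows "E_stage r DD \<gamma> \<subseteq> DD \<gamma>"
proof -
  have *: "E \<subseteq> {d + of_int k *\<^sub>R w | d k. d \<in> E}" for E :: "'a ell1 set" and w
  proof
    fix x assume "x \<in> E"
    \<comment> \<open>The coefficient 0 of the new generator recovers the old elements.\<close>
    moreover have "x = x + of_int 0 *\<^sub>R w" by simp
    ultimately show "x \<in> {d + of_int k *\<^sub>R w | d k. d \<in> E}" by blast
  qed
  have "underS r \<gamma> = {} \<or> DD \<gamma> = E_stage r DD \<gamma> \<or>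
      (\<exists>w. DD \<gamma> = {d + of_int k *\<^sub>R w | d k. d \<in> E_stage r DD \<gamma>})"
    using assms[unfolded transfinite_construction_def, rule_format, of \<gamma>]
    by (simp split: if_splits) blast
  then show ?thesis
  proof (elim disjE exE)
    assume "underS r \<gamma> = {}"
    then show ?thesis by (simp add: E_stage_def)
  next
    fix w
    assume "DD \<gamma> = {d + of_int k *\<^sub>R w | d k. d \<in> E_stage r DD \<gamma>}"
    then show ?thesis using *[of "E_stage r DD \<gamma>" w] by simp
  qed simp
qed

text \<open>A strictly earlier stage is one of the sets united in \<open>E_stage\<close>, hence
  contained in the later stage; totality of the well-order does the rest.\<close>

lemma stages_comparable:
  assumes "card_order r" "transfinite_construction r u DD"
  shows "DD \<alpha> \<subseteq> DD \<beta> \<or> DD \<beta> \<subseteq> DD \<alpha>"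
proof -
  have mono: "DD \<alpha> \<subseteq> DD \<beta>" if "(\<alpha>, \<beta>) \<in> r" for \<alpha> \<beta>
    using that E_stage_subset[OF assms(2), of \<beta>]
    by (cases "\<alpha> = \<beta>") (auto simp: E_stage_def underS_def)
  have "wo_rel r" "Field r = UNIV"
    using well_order_on_Well_order[OF card_order_on_well_order_on[OF assms(1)]]
    by (auto simp: wo_rel_def)
  then have "(\<alpha>, \<beta>) \<in> r \<or> (\<beta>, \<alpha>) \<in> r"
    using wo_rel.TOTALS[of r] by auto
  with mono show ?thesis by blast
qed

lemma two_separated_group_stage:
  assumes "card_order r" "transfinite_construction r u DD"
  shows "two_separated_group (DD \<gamma>)"
proof -
  have wo: "wo_rel r"
    using well_order_on_Well_order[OF card_order_on_well_order_on[OF assms(1)]]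
    by (auto simp: wo_rel_def)
  show ?thesis
  proof (induction \<gamma> rule: wo_rel.well_order_induct[OF wo])
    case (1 \<gamma>)
    note step = assms(2)[unfolded transfinite_construction_def, rule_format, of \<gamma>]
    show ?case
    proof (cases "underS r \<gamma> = {}")
      case True
      then show ?thesis using step by (simp add: two_separated_group_def)
    next
      case False
      \<comment> \<open>The induction hypothesis covers all earlier stages; they form a chain,
        nonempty since \<open>\<gamma>\<close> is not the least element, so the invariant passes to
        their union.\<close>
      have E: "two_separated_group (E_stage r DD \<gamma>)"
        unfolding E_stage_def
        using False 1 stages_comparable[OF assms]
        by (intro two_separated_group_directed_Union) (auto simp: underS_def)
      show ?thesis
      proof (cases "\<exists>d\<in>E_stage r DD \<gamma>. norm (u \<gamma> - d) \<le> 1")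
        case True
        then show ?thesis using step False E by simp
      next
        case far: False
        with step False obtain \<gamma>' where
          "\<gamma>' \<notin> supp (u \<gamma>) \<union> (\<Union>d\<in>E_stage r DD \<gamma>. supp d)"
          "DD \<gamma> = {d + of_int k *\<^sub>R (u \<gamma> + basis \<gamma>') | d k. d \<in> E_stage r DD \<gamma>}"
          by auto
        with E far show ?thesis
          using two_separated_group_extend[of "E_stage r DD \<gamma>" "u \<gamma>" \<gamma>'] by (force simp: not_le)
      qed
    qed
  qed
qed

section \<open>Tiles through a common point\<close>

lemma card_le_2I:
  assumes "\<And>a b c. a \<in> S \<Longrightarrow> b \<in> S \<Longrightarrow> c \<in> S \<Longrightarrow> a = b \<or> b = c \<or> a = c"
  shows "finite S \<and> card S \<le> 2"
proof (rule ccontr)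
  assume "\<not> (finite S \<and> card S \<le> 2)"
  \<comment> \<open>Infinite sets have subsets of every finite cardinality, so both ways of failing
    the bound yield three distinct elements.\<close>
  then obtain T where "T \<subseteq> S" "card T = 3"
    by (metis infinite_arbitrarily_large obtain_subset_with_card_n not_less_eq_eq
        numeral_2_eq_2 numeral_3_eq_3)
  then obtain a b c where "{a, b, c} \<subseteq> S" "a \<noteq> b" "b \<noteq> c" "a \<noteq> c"
    by (auto simp: card_3_iff)
  with assms[of a b c] show False by auto
qed

lemma mem_tile_iff: "x \<in> (+) d ` cball 0 1 \<longleftrightarrow> norm (x - d) \<le> 1"
  by (auto simp: image_iff dist_norm norm_minus_commute intro: bexI[of _ "x - d"])

lemma point_2_finite_tiles:
  assumes D: "two_separated_group D"
  shows "point_n_finite 2 (tiles D)"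
proof -
  have centres: "d - d' \<in> (*\<^sub>R) 2 ` signed_basis"
    if "d \<in> D" "d' \<in> D" "d \<noteq> d'" "norm (x - d) \<le> 1" "norm (x - d') \<le> 1" for d d' x
  proof (rule two_separated_group_norm_le_2[OF D])
    show "d - d' \<in> D" "d - d' \<noteq> 0"
      using two_separated_group_diff[OF D] that by auto
    \<comment> \<open>The triangle inequality through the common point: \<open>d - d'\<close> equals
      \<open>(x - d') - (x - d)\<close>.\<close>
    have "norm (d - d') \<le> norm (x - d') + norm (x - d)"
      using norm_triangle_ineq4[of "x - d'" "x - d"] by simp
    with that show "norm (d - d') \<le> 2" by simp
  qed
  have three: "d1 = d2 \<or> d2 = d3 \<or> d1 = d3"
    if "d1 \<in> D" "d2 \<in> D" "d3 \<in> D" "norm (x - d1) \<le> 1" "norm (x - d2) \<le> 1" "norm (x - d3) \<le> 1"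
    for d1 d2 d3 x
  proof (rule ccontr)
    assume neq: "\<not> ?thesis"
    have "d1 - d2 \<in> (*\<^sub>R) 2 ` signed_basis" "d2 - d3 \<in> (*\<^sub>R) 2 ` signed_basis"
      "d1 - d3 \<in> (*\<^sub>R) 2 ` signed_basis"
      by (rule centres[of _ _ x]; use that neq in blast)+
    then obtain a b c where abc: "a \<in> signed_basis" "b \<in> signed_basis" "c \<in> signed_basis"
      "d1 - d2 = 2 *\<^sub>R a" "d2 - d3 = 2 *\<^sub>R b" "d1 - d3 = 2 *\<^sub>R c"
      by (elim imageE)
    have "d1 - d3 = (d1 - d2) + (d2 - d3)" by simp
    then have "2 *\<^sub>R c = 2 *\<^sub>R (a + b)"
      using abc by (simp add: scaleR_add_right)
    then have "a + b = c" by simp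
    with abc(3) have "norm (a + b) = 1"
      using norm_signed_basis by blast
    moreover from this have "a + b \<noteq> 0"
      using norm_zero by fastforce
    ultimately show False
      using norm_add_signed_basis[OF abc(1,2)] by simp
  qed
  show ?thesis
    unfolding point_n_finite_def
  proof (intro allI card_le_2I)
    fix x a b c
    assume abc: "a \<in> {T \<in> tiles D. x \<in> T}" "b \<in> {T \<in> tiles D. x \<in> T}" "c \<in> {T \<in> tiles D. x \<in> T}"
    \<comment> \<open>Tiles are counted as sets, so a centre is picked for each; equal centres then
      give equal tiles. Removing \<open>image_add_cball\<close> from the simpset keeps the image
      form that \<open>mem_tile_iff\<close> matches.\<close>
    have centre: "\<exists>d\<in>D. T = (+) d ` cball 0 1 \<and> norm (x - d) \<le> 1" if "T \<in> {T \<in> tiles D. x \<in> T}" for T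
      using that unfolding tiles_def by (auto simp: mem_tile_iff simp del: image_add_cball)
    obtain d1 d2 d3 where "d1 \<in> D" "d2 \<in> D" "d3 \<in> D"
      "norm (x - d1) \<le> 1" "norm (x - d2) \<le> 1" "norm (x - d3) \<le> 1"
      "a = (+) d1 ` cball 0 1" "b = (+) d2 ` cball 0 1" "c = (+) d3 ` cball 0 1"
      using abc[THEN centre] by blast
    then show "a = b \<or> b = c \<or> a = c"
      using three[of d1 d2 d3 x] by blast
  qed
qed

text \<open>A tile other than the central one has a nonzero centre, of norm at most 2 because
  \<open>x\<close> is within 1 of both centres. That centre is thus twice a signed basis vector, and
  \<open>x\<close> is the midpoint.\<close>

lemma contact_points:
  assumes D: "two_separated_group D"
    and x: "norm x \<le> 1" "T \<in> tiles D" "T \<noteq> cball 0 1" "x \<in> T"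
  shows "x \<in> signed_basis"
proof -
  obtain d where d: "d \<in> D" "T = (+) d ` cball 0 1"
    using x(2) by (auto simp: tiles_def)
  then have xd: "norm (x - d) \<le> 1" using x(4) mem_tile_iff by blast
  have "d \<noteq> 0" using d(2) x(3) by auto
  moreover have "norm d \<le> 2"
    using norm_triangle_ineq4[of x "x - d"] x(1) xd by simp
  ultimately have "d \<in> (*\<^sub>R) 2 ` signed_basis"
    using two_separated_group_norm_le_2[OF D d(1)] by blast
  then obtain \<alpha> where "d = 2 *\<^sub>R basis \<alpha> \<or> d = - (2 *\<^sub>R basis \<alpha>)"
    unfolding scaleR_2_signed_basis by blast
  then have "x = basis \<alpha> \<or> - x = basis \<alpha>"
  proof
    assume "d = 2 *\<^sub>R basis \<alpha>"
    then show ?thesis using eq_basis_if_norm_le_1[of x] x(1) xd by simp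
  next
    assume "d = - (2 *\<^sub>R basis \<alpha>)"
    \<comment> \<open>Reflection in the origin reduces the negative sign to the positive
      one.\<close>
    then have "norm (- x - 2 *\<^sub>R basis \<alpha>) \<le> 1"
      using xd norm_minus_cancel[of "x - d"] by simp
    then show ?thesis using eq_basis_if_norm_le_1[of "- x"] x(1) by simp
  qed
  then have "x = basis \<alpha> \<or> x = - basis \<alpha>"
    by (metis minus_minus)
  then show ?thesis
    unfolding signed_basis_def by blast
qed

theorem theorem3p14:
  fixes r :: "'a rel"
    and u :: "'a \<Rightarrow> 'a ell1"
    and DD :: "'a \<Rightarrow> 'a ell1 set"
    and D :: "'a ell1 set"
  assumes "card_order r" and "cinfinite r"
    and "r ^c natLeq =o r"
    and "bij u"
    and "\<And>\<alpha>. underS r \<alpha> = {} \<Longrightarrow> u \<alpha> = 0"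
    and "transfinite_construction r u DD"
    and "D = (\<Union>\<alpha>. DD \<alpha>)"
  shows "D \<inter> (\<lambda>x. 2 *\<^sub>R x) ` sphere 0 1 \<subseteq> {2 *\<^sub>R basis \<alpha> | \<alpha>. True} \<union> {- (2 *\<^sub>R basis \<alpha>) | \<alpha>. True}
    \<and> point_n_finite 2 (tiles D)
    \<and> {x \<in> cball 0 1. \<exists>T\<in>tiles D. T \<noteq> cball 0 1 \<and> x \<in> T}
        \<subseteq> {basis \<alpha> | \<alpha>. True} \<union> {- basis \<alpha> | \<alpha>. True}"
proof -
  \<comment> \<open>\<open>D\<close> is itself the union of a chain, now over all stages, so it
    inherits the invariant.\<close>
  have D: "two_separated_group D"
    unfolding assms(7)
    using two_separated_group_stage[OF assms(1,6)] stages_comparable[OF assms(1,6)]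
    by (intro two_separated_group_directed_Union) auto
  have "D \<inter> (\<lambda>x. 2 *\<^sub>R x) ` sphere 0 1 \<subseteq> (*\<^sub>R) 2 ` signed_basis"
  proof
    fix x assume "x \<in> D \<inter> (\<lambda>x. 2 *\<^sub>R x) ` sphere 0 1"
    then have "x \<in> D" "norm x = 2" "x \<noteq> 0" by auto
    then show "x \<in> (*\<^sub>R) 2 ` signed_basis"
      using two_separated_group_norm_le_2[OF D, of x] by auto
  qed
  moreover have "{x \<in> cball 0 1. \<exists>T\<in>tiles D. T \<noteq> cball 0 1 \<and> x \<in> T} \<subseteq> signed_basis"
    using contact_points[OF D] by auto
  ultimately show ?thesis
    using point_2_finite_tiles[OF D] unfolding scaleR_2_signed_basis unfolding signed_basis_def by blast
qed

end
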